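(* Consider representations of a positive integer as $h-k$ with $h,k$ harmonic numbers. Then: (i) The only such representations of $3$ are $4-1$, $6-3$, $9-6$, $12-9$, and $27-24$. (ii) The only such representations of $5$ are $6-1$, $9-4$, $8-3$, and $32-27$. (iii) The only such representations of $17$ are $18-1$ and $81-64$. (iv) For every integer $k\ge 3$ such that $F_k=2^{2^k}+1$ is prime, $F_k$ is an $ndh$-number.
   Context: A harmonic number is a positive integer of the form $2^a3^b$ with $a,b\ge 0$ integers (so $1$ is harmonic). A positive integer is an $ndh$-number if it cannot be written as a difference $h-k$ of two harmonic numbers $h,k$. A Fermat prime is a prime of the form $F_k=2^{2^k}+1$, $k\ge 0$. *)

theory Defs
  imports Complex_Main "HOL-Computational_Algebra.Primes"
begin

definition harmonic :: "nat \<Rightarrow> bool" where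
  "harmonic n \<longleftrightarrow> (\<exists>a b. n = 2 ^ a * 3 ^ b)"

text \<open>The difference is taken in the integers, since subtraction on the naturals truncates.\<close>

definition harmonic_diff_reps :: "nat \<Rightarrow> (nat \<times> nat) set" where
  "harmonic_diff_reps n = {(h, k). harmonic h \<and> harmonic k \<and> int n = int h - int k}"

definition ndh_number :: "nat \<Rightarrow> bool" where
  "ndh_number n \<longleftrightarrow> n > 0 \<and> (\<nexists>h k. harmonic h \<and> harmonic k \<and> int n = int h - int k)"

definition fermat :: "nat \<Rightarrow> nat" where
  "fermat k = 2 ^ (2 ^ k) + 1"

end

theory Submission
  imports Defs
begin

text \<open>Let \<open>p = 2 ^ N + 1\<close> be a prime with \<open>N \<ge> 2\<close> even. As \<open>p\<close> is prime to 6, a representation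
  \<open>h = k + p\<close> has \<open>k = 1\<close>, or \<open>h\<close> and \<open>k\<close> are powers of 2 and 3 in one of the two orders.
  If \<open>k = 1\<close>, then \<open>h = 2 * 3 ^ b\<close> with \<open>3 ^ b = 2 ^ (N - 1) + 1\<close>.
  If \<open>3 ^ b = 2 ^ a + p\<close>, then congruences modulo 3 and 4 show that \<open>a\<close> and \<open>b\<close> are even, so \<open>p\<close>
  is a difference of two squares, and primality again forces \<open>3 ^ c = 2 ^ (N - 1) + 1\<close>.
  That equation is impossible for \<open>N > 4\<close> by congruences modulo 16 and 5.
  If \<open>2 ^ a = 3 ^ b + p\<close>, then \<open>N = 2\<close> by a congruence modulo 8, and \<open>2 ^ a = 3 ^ b + 5\<close> with
  \<open>a \<ge> 6\<close> is impossible by congruences modulo 64 and 17.\<close>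

section \<open>Residues of powers of 2 and 3\<close>

lemma power3_mod_8: "(3::nat) ^ b mod 8 \<in> {1, 3}"
proof (induction b)
  case (Suc b)
  have "(3::nat) ^ Suc b mod 8 = 3 * (3 ^ b mod 8) mod 8"
    by (simp add: mod_mult_right_eq)
  with Suc show ?case by auto
qed simp

text \<open>Here 80 = 16 * 5, and 3 has order 4 modulo both factors, so the residue of a power of 3
  modulo 16 determines the one modulo 5.\<close>

lemma power3_mod_80: "(3::nat) ^ b mod 80 \<in> {1, 3, 9, 27}"
proof (induction b)
  case (Suc b)
  have "(3::nat) ^ Suc b mod 80 = 3 * (3 ^ b mod 80) mod 80"
    by (simp add: mod_mult_right_eq)
  with Suc show ?case by auto
qed simp

text \<open>Likewise 1088 = 64 * 17, and 3 has order 16 modulo both 64 and 17.\<close>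

lemma power3_mod_1088:
  "(3::nat) ^ b mod 1088 \<in> {1, 3, 9, 27, 81, 243, 729, 11, 33, 99, 297, 891, 497, 403, 121, 363}"
proof (induction b)
  case (Suc b)
  have "(3::nat) ^ Suc b mod 1088 = 3 * (3 ^ b mod 1088) mod 1088"
    by (simp add: mod_mult_right_eq)
  with Suc show ?case by auto
qed simp

lemma power2_mod_17: "(2::nat) ^ j mod 17 \<in> {1, 2, 4, 8, 16, 15, 13, 9}"
proof (induction j)
  case (Suc j)
  have "(2::nat) ^ Suc j mod 17 = 2 * (2 ^ j mod 17) mod 17"
    by (simp add: mod_mult_right_eq)
  with Suc show ?case by auto
qed simp

lemma power2_mod_1088: "(2::nat) ^ (6 + j) mod 1088 = 64 * (2 ^ j mod 17)"
  using mult_mod_right[of "64::nat" "2 ^ j" 17] by (simp add: power_add)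

lemma power2_mod_3: "(2::nat) ^ a mod 3 = (if even a then 1 else 2)"
proof (induction a)
  case (Suc a)
  have "(2::nat) ^ Suc a mod 3 = 2 * (2 ^ a mod 3) mod 3"
    by (simp add: mod_mult_right_eq)
  with Suc show ?case by auto
qed simp

lemma power3_mod_4: "(3::nat) ^ b mod 4 = (if even b then 1 else 3)"
proof (induction b)
  case (Suc b)
  have "(3::nat) ^ Suc b mod 4 = 3 * (3 ^ b mod 4) mod 4"
    by (simp add: mod_mult_right_eq)
  with Suc show ?case by auto
qed simp

section \<open>Exponential equations in powers of 2 and 3\<close>

lemma power3_eq_power2_plus_1:
  assumes "(3::nat) ^ b = 2 ^ m + 1"
  shows "m = 1 \<or> m = 3"
proof (cases "m < 4")
  case True
  then have "m \<in> {0, 1, 2, 3}" by auto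
  then show ?thesis using assms power3_mod_80[of b] by auto
next
  case False
  then have "(16::nat) dvd 2 ^ m"
    using le_imp_power_dvd[of 4 m "2::nat"] by simp
  then have "(3::nat) ^ b mod 16 = 1" unfolding assms by (auto elim!: dvdE)
  then have "(3::nat) ^ b mod 80 mod 16 = 1" by (simp add: mod_mod_cancel)
  \<comment> \<open>Among 1, 3, 9, 27 only 1 is congruent to 1 modulo 16; modulo 5 this leaves
    \<open>2 ^ m\<close> congruent to 0.\<close>
  then have "(3::nat) ^ b mod 80 = 1" using power3_mod_80[of b] by auto
  then have "(3::nat) ^ b mod 80 mod 5 = 1" by simp
  then have "(2 ^ m + 1) mod 5 = (1::nat)" unfolding assms by (simp add: mod_mod_cancel)
  then have "(5::nat) dvd 2 ^ m" by presburger
  then have "(5::nat) dvd 2"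
    by (rule prime_dvd_power[rotated]) simp
  then show ?thesis by simp
qed

text \<open>Powers of 3 are never -1 modulo 8, which bounds \<open>a\<close>.\<close>

lemma power2_eq_power3_plus_1:
  assumes "(2::nat) ^ a = 3 ^ b + 1"
  shows "a = 1 \<or> a = 2"
proof (cases "a < 3")
  case True
  then have "a \<in> {0, 1, 2}" by auto
  then show ?thesis using assms by auto
next
  case False
  then have "(8::nat) dvd 2 ^ a"
    using le_imp_power_dvd[of 3 a "2::nat"] by simp
  then have "(8::nat) dvd 3 ^ b + 1" unfolding assms .
  then have "(3::nat) ^ b mod 8 = 7" by presburger
  then show ?thesis using power3_mod_8[of b] by auto
qed

lemma power2_eq_power3_plus_5:
  assumes "(2::nat) ^ a = 3 ^ b + 5"
  shows "a = 3 \<or> a = 5"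
proof (cases "a < 6")
  case True
  then have "a \<in> {0, 1, 2, 3, 4, 5}" by auto
  then show ?thesis using assms power3_mod_80[of b] by auto
next
  case False
  then obtain j where j: "a = 6 + j" by (metis le_Suc_ex not_less)
  have "(2::nat) ^ (6 + j) mod 1088 = (3 ^ b mod 1088 + 5) mod 1088"
    using assms unfolding j by (simp only: mod_add_left_eq)
  \<comment> \<open>Modulo 64 the power of 3 must be -5, which singles out the residue 891 modulo
    1088. Then \<open>3 ^ b + 5\<close> is 12 modulo 17, which is not a power of 2 there.\<close>
  then show ?thesis
    using power2_mod_17[of j] power3_mod_1088[of b] unfolding power2_mod_1088 by auto
qed

lemma power2_eq_power3_plus_fermat:
  assumes "(2::nat) ^ a = 3 ^ b + 2 ^ N + 1" and "N \<ge> 2"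
  shows "N = 2 \<and> (a = 3 \<or> a = 5)"
proof (cases "N = 2")
  case True
  with assms(1) show ?thesis using power2_eq_power3_plus_5[of a b] by simp
next
  case False
  with assms(2) have N: "N \<ge> 3" by simp
  \<comment> \<open>As \<open>a\<close> exceeds \<open>N\<close>, both powers of 2 vanish modulo 8,
    leaving \<open>3 ^ b\<close> congruent to -1.\<close>
  have "(2::nat) ^ N < 2 ^ a" using assms(1) by simp
  then have "N < a" by simp
  with N have "(8::nat) dvd 2 ^ N" "(8::nat) dvd 2 ^ a"
    using le_imp_power_dvd[of 3 N "2::nat"] le_imp_power_dvd[of 3 a "2::nat"] by simp_all
  then have "(8::nat) dvd (3 ^ b + 1) + 2 ^ N" "(8::nat) dvd 2 ^ N"
    unfolding assms(1) by (simp_all add: ac_simps)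
  then have "(8::nat) dvd 3 ^ b + 1" by (simp only: dvd_add_left_iff)
  then have "(3::nat) ^ b mod 8 = 7" by presburger
  then show ?thesis using power3_mod_8[of b] by auto
qed

lemma power3_eq_power2_plus_fermat_prime:
  assumes eq: "(3::nat) ^ b = 2 ^ a + 2 ^ N + 1"
    and p: "prime (2 ^ N + 1 :: nat)" and N: "even N" "N \<ge> 2"
  shows "(N = 2 \<and> 3 ^ b = (9::nat)) \<or> (N = 4 \<and> 3 ^ b = (81::nat))"
proof -
  have "b \<noteq> 0" using eq by (intro notI) simp
  then have "(3::nat) dvd 2 ^ a + 2 ^ N + 1" unfolding eq[symmetric] by simp
  moreover have "(2::nat) ^ N mod 3 = 1" using N by (simp add: power2_mod_3)
  ultimately have "(2::nat) ^ a mod 3 = 1" by presburger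
  then have "even a" by (simp add: power2_mod_3 split: if_splits)
  then obtain d where a: "a = 2 * d" by auto
  have 4: "(4::nat) dvd 2 ^ N" using le_imp_power_dvd[of 2 N "2::nat"] N by simp
  have "odd ((3::nat) ^ b)" by simp
  then have "even ((2::nat) ^ a)" unfolding eq using N by simp
  then have "d \<noteq> 0" using a by (intro notI) simp
  then have "(4::nat) dvd 2 ^ a" using le_imp_power_dvd[of 2 a "2::nat"] a by simp
  with 4 obtain q r where "(2::nat) ^ N = 4 * q" "(2::nat) ^ a = 4 * r" by (auto elim!: dvdE)
  then have "(3::nat) ^ b = 1 + 4 * (q + r)" using eq by simp
  then have "(3::nat) ^ b mod 4 = 1" by (simp only: mod_mult_self2) simp
  then have "even b" by (simp add: power3_mod_4 split: if_splits)
  then obtain c where b: "b = 2 * c" by auto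
  define x y :: nat where "x = 3 ^ c" and "y = 2 ^ d"
  have sq: "x * x = y * y + (2 ^ N + 1)"
    using eq by (simp add: a b x_def y_def power_mult power2_eq_square flip: power_mult_distrib)
  then have "y * y < x * x" by simp
  then have "y < x" by (meson mult_le_mono not_less)
  then obtain z where "x = y + z" using less_imp_add_positive by blast
  then have "(x - y) * (x + y) = 2 ^ N + 1"
    using sq by (simp add: algebra_simps)
  \<comment> \<open>A factorization of a prime has a factor 1; positivity of \<open>y\<close> and
    \<open>y < x\<close> then rule out \<open>x + y = 1\<close>.\<close>
  moreover from this have "x - y = 1 \<or> x + y = 1"
    using p by (metis prime_product)
  moreover have "y > 0" by (simp add: y_def)
  ultimately have "x = y + 1" "x + y = 2 ^ N + 1" using \<open>y < x\<close> by auto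
  then have "2 * y = 2 ^ N" by simp
  then have "(2::nat) ^ Suc d = 2 ^ N" by (simp add: y_def)
  then have "N = Suc d" by (metis one_less_numeral_iff power_inject_exp semiring_norm(76))
  \<comment> \<open>The relation \<open>x = y + 1\<close> reads
    \<open>3 ^ c = 2 ^ d + 1\<close>.\<close>
  moreover have "d = 1 \<or> d = 3"
    using \<open>x = y + 1\<close> power3_eq_power2_plus_1[of c d] by (simp add: x_def y_def)
  ultimately show ?thesis using eq a by auto
qed

text \<open>The right-hand side is 2 modulo 4, so \<open>a = 1\<close>; halving gives a power of 3
  that is one more than a power of 2.\<close>

lemma power2_times_power3_eq_fermat_plus_1:
  assumes eq: "(2::nat) ^ a * 3 ^ b = 2 ^ N + 2" and N: "even N" "N \<ge> 2"
  shows "N = 2 \<or> N = 4"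
proof -
  have "(4::nat) dvd 2 ^ N" using le_imp_power_dvd[of 2 N "2::nat"] N by simp
  then have n4: "\<not> (4::nat) dvd 2 ^ a * 3 ^ b" unfolding eq by presburger
  have "\<not> 2 \<le> a"
    using n4 le_imp_power_dvd[of 2 a "2::nat"] by (auto intro: dvd_mult2)
  moreover have "a \<noteq> 0"
  proof
    assume "a = 0"
    with eq have "(3::nat) ^ b = 2 ^ N + 2" by simp
    moreover have "odd ((3::nat) ^ b)" by simp
    ultimately show False using N by simp
  qed
  ultimately have a: "a = 1" by simp
  from N obtain m where m: "N = Suc m" by (cases N) auto
  have "(3::nat) ^ b = 2 ^ m + 1" using eq by (simp add: a m)
  then have "m = 1 \<or> m = 3" by (rule power3_eq_power2_plus_1)
  with m show ?thesis by auto
qed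

section \<open>Differences of harmonic numbers\<close>

lemma three_dvd_power2_times_power3: "3 dvd (2::nat) ^ i * 3 ^ j \<longleftrightarrow> j > 0"
  by (cases j) (auto simp: dvd_eq_mod_eq_0 power2_mod_3)

text \<open>A common factor 2 or 3 of \<open>h\<close> and \<open>k\<close> would divide
  \<open>n\<close>, so each of these primes divides at most one of them. The case
  \<open>h = 1\<close> drops out because \<open>h > k\<close>.\<close>

lemma harmonic_coprime_6_cases:
  assumes h: "harmonic h" and k: "harmonic k" and hk: "h = k + n"
    and n2: "odd n" and n3: "\<not> 3 dvd n"
  obtains (one) a b where "h = 2 ^ a * 3 ^ b" "k = 1"
    | (two_three) a b where "h = 2 ^ a" "k = 3 ^ b"
    | (three_two) a b where "h = 3 ^ b" "k = 2 ^ a"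
proof -
  obtain a b c d where e: "h = 2 ^ a * 3 ^ b" "k = 2 ^ c * 3 ^ d"
    using h k unfolding harmonic_def by auto
  have "\<not> (2 dvd h \<and> 2 dvd k)" using n2 hk by auto
  then have "a = 0 \<or> c = 0" unfolding e by auto
  moreover have "\<not> (3 dvd h \<and> 3 dvd k)" using n3 unfolding hk by (metis dvd_add_right_iff)
  then have "b = 0 \<or> d = 0" unfolding e three_dvd_power2_times_power3 by auto
  moreover have "\<not> (a = 0 \<and> b = 0)"
  proof
    assume "a = 0 \<and> b = 0"
    then have "h = 1" by (simp add: e)
    moreover have "k > 0" "n > 0" using e n2 by (auto intro: odd_pos)
    ultimately show False using hk by simp
  qed
  ultimately consider "a = 0" "d = 0" | "b = 0" "c = 0" | "c = 0" "d = 0" by blast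
  then show thesis
  proof cases
    case 1
    with e show thesis by (intro three_two) simp_all
  next
    case 2
    with e show thesis by (intro two_three) simp_all
  next
    case 3
    with e show thesis by (intro one) simp_all
  qed
qed

text \<open>Serves 5 (\<open>N = 2\<close>), 17 (\<open>N = 4\<close>) and all larger Fermat primes
  at once. Evenness of \<open>N\<close> makes the prime 2 modulo 3, hence prime to 6.\<close>

lemma fermat_prime_harmonic_diff:
  assumes hk: "harmonic h" "harmonic k" "h = k + (2 ^ N + 1)"
    and p: "prime (2 ^ N + 1 :: nat)" and N: "even N" "N \<ge> 2"
  shows "(N = 2 \<and> (h, k) \<in> {(6, 1), (9, 4), (8, 3), (32, 27)}) \<or>
    (N = 4 \<and> (h, k) \<in> {(18, 1), (81, 64)})"
proof -
  have odd: "odd (2 ^ N + 1 :: nat)" using N by simp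
  have "(2::nat) ^ N mod 3 = 1" using N by (simp add: power2_mod_3)
  then have "\<not> (3::nat) dvd 2 ^ N + 1" by presburger
  with hk odd show ?thesis
  proof (cases rule: harmonic_coprime_6_cases)
    case (one a b)
    then have "(2::nat) ^ a * 3 ^ b = 2 ^ N + 2" using hk by simp
    from power2_times_power3_eq_fermat_plus_1[OF this N] show ?thesis
      using one hk(3) by auto
  next
    case (two_three a b)
    then have "(2::nat) ^ a = 3 ^ b + 2 ^ N + 1" using hk by simp
    from power2_eq_power3_plus_fermat[OF this N(2)] show ?thesis
      using two_three hk(3) by auto
  next
    case (three_two a b)
    then have "(3::nat) ^ b = 2 ^ a + 2 ^ N + 1" using hk by simp
    from power3_eq_power2_plus_fermat_prime[OF this p N] show ?thesis
      using three_two hk(3) by auto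
  qed
qed

lemma harmonic_diff_1:
  assumes hk: "harmonic h" "harmonic k" "h = k + 1"
  shows "(h, k) \<in> {(2, 1), (3, 2), (4, 3), (9, 8)}"
proof -
  have "odd (1::nat)" "\<not> (3::nat) dvd 1" by simp_all
  with hk show ?thesis
  proof (cases rule: harmonic_coprime_6_cases)
    case (one a b)
    then show ?thesis using hk by simp
  next
    case (two_three a b)
    then have "(2::nat) ^ a = 3 ^ b + 1" using hk by simp
    from power2_eq_power3_plus_1[OF this] show ?thesis
      using two_three hk(3) by auto
  next
    case (three_two a b)
    then have "(3::nat) ^ b = 2 ^ a + 1" using hk by simp
    from power3_eq_power2_plus_1[OF this] show ?thesis
      using three_two hk(3) by auto
  qed
qed

text \<open>Either 3 divides both numbers, and dividing by 3 reduces to difference 1, or both are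
  powers of 2, and parity makes one of them 1.\<close>

lemma harmonic_diff_3:
  assumes "harmonic h" "harmonic k" "h = k + 3"
  shows "(h, k) \<in> {(4, 1), (6, 3), (9, 6), (12, 9), (27, 24)}"
proof -
  obtain a b c d where e: "h = 2 ^ a * 3 ^ b" "k = 2 ^ c * 3 ^ d"
    using assms unfolding harmonic_def by auto
  have "3 dvd h \<longleftrightarrow> 3 dvd k" using assms(3) by simp
  then have bd: "b > 0 \<longleftrightarrow> d > 0" unfolding e three_dvd_power2_times_power3 .
  show ?thesis
  proof (cases "b > 0")
    case True
    with bd obtain b' d' where bd': "b = Suc b'" "d = Suc d'" by (metis gr0_implies_Suc)
    define h' k' :: nat where "h' = 2 ^ a * 3 ^ b'" and "k' = 2 ^ c * 3 ^ d'"
    have hk': "h = 3 * h'" "k = 3 * k'" by (simp_all add: e bd' h'_def k'_def)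
    have "harmonic h'" "harmonic k'" unfolding h'_def k'_def harmonic_def by blast+
    moreover have "h' = k' + 1" using assms(3) hk' by simp
    ultimately have "(h', k') \<in> {(2, 1), (3, 2), (4, 3), (9, 8)}" by (rule harmonic_diff_1)
    with hk' show ?thesis by auto
  next
    case False
    with bd e have e: "h = 2 ^ a" "k = 2 ^ c" by simp_all
    have "odd h \<or> odd k" using assms(3) by simp
    then have "a = 0 \<or> c = 0" using e by auto
    moreover have "a \<noteq> 0" using e assms(3) by (intro notI) simp
    ultimately show ?thesis using e assms(3) by simp
  qed
qed

lemma harmonic_power2_times_power3: "harmonic (2 ^ a * 3 ^ b)"
  unfolding harmonic_def by blast

text \<open>Replaces the integer difference by the addition \<open>h = k + n\<close> on naturals,
  the form used in all the lemmas above.\<close>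

lemma harmonic_diff_reps_eqI:
  assumes "\<And>h k. harmonic h \<Longrightarrow> harmonic k \<Longrightarrow> h = k + n \<Longrightarrow> (h, k) \<in> R"
    and "\<And>h k. (h, k) \<in> R \<Longrightarrow> harmonic h \<and> harmonic k \<and> h = k + n"
  shows "harmonic_diff_reps n = R"
proof -
  have "int n = int h - int k \<longleftrightarrow> h = k + n" for h k by linarith
  then have "(h, k) \<in> harmonic_diff_reps n \<longleftrightarrow> harmonic h \<and> harmonic k \<and> h = k + n" for h k
    by (simp only: harmonic_diff_reps_def mem_Collect_eq prod.case)
  with assms have "(h, k) \<in> harmonic_diff_reps n \<longleftrightarrow> (h, k) \<in> R" for h k by metis
  then show ?thesis by (intro set_eqI) (simp only: split_paired_all)
qed

theorem theorem2p6:
  shows "harmonic_diff_reps 3 = {(4, 1), (6, 3), (9, 6), (12, 9), (27, 24)} \<and>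
    harmonic_diff_reps 5 = {(6, 1), (9, 4), (8, 3), (32, 27)} \<and>
    harmonic_diff_reps 17 = {(18, 1), (81, 64)} \<and>
    (\<forall>k\<ge>3. prime (fermat k) \<longrightarrow> ndh_number (fermat k))"
proof (intro conjI allI impI)
  have harm: "harmonic 1" "harmonic 3" "harmonic 4" "harmonic 6" "harmonic 8" "harmonic 9"
    "harmonic 12" "harmonic 18" "harmonic 24" "harmonic 27" "harmonic 32" "harmonic 64"
    "harmonic 81"
    using harmonic_power2_times_power3[of 0 0]
      harmonic_power2_times_power3[of 0 1]
      harmonic_power2_times_power3[of 2 0]
      harmonic_power2_times_power3[of 1 1]
      harmonic_power2_times_power3[of 3 0]
      harmonic_power2_times_power3[of 0 2]
      harmonic_power2_times_power3[of 2 1]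
      harmonic_power2_times_power3[of 1 2]
      harmonic_power2_times_power3[of 3 1]
      harmonic_power2_times_power3[of 0 3]
      harmonic_power2_times_power3[of 5 0]
      harmonic_power2_times_power3[of 6 0]
      harmonic_power2_times_power3[of 0 4]
    by simp_all
  show "harmonic_diff_reps 3 = {(4, 1), (6, 3), (9, 6), (12, 9), (27, 24)}"
    by (rule harmonic_diff_reps_eqI, rule harmonic_diff_3) (use harm in auto)
  show "harmonic_diff_reps 5 = {(6, 1), (9, 4), (8, 3), (32, 27)}"
  proof (rule harmonic_diff_reps_eqI)
    fix h k assume "harmonic h" "harmonic k" "h = k + 5"
    then show "(h, k) \<in> {(6, 1), (9, 4), (8, 3), (32, 27)}"
      using fermat_prime_harmonic_diff[of h k 2] by simp
  qed (use harm in auto)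
  show "harmonic_diff_reps 17 = {(18, 1), (81, 64)}"
  proof (rule harmonic_diff_reps_eqI)
    fix h k assume "harmonic h" "harmonic k" "h = k + 17"
    then show "(h, k) \<in> {(18, 1), (81, 64)}"
      using fermat_prime_harmonic_diff[of h k 4] by simp
  qed (use harm in auto)
  fix k :: nat
  assume k: "k \<ge> 3" and p: "prime (fermat k)"
  \<comment> \<open>The exponent \<open>2 ^ k\<close> thus differs from 2 and 4, the only ones that
    allow a representation.\<close>
  have N: "(8::nat) \<le> 2 ^ k" using power_increasing[OF k, of "2::nat"] by simp
  show "ndh_number (fermat k)"
    unfolding ndh_number_def
  proof (intro conjI notI)
    show "fermat k > 0" by (simp add: fermat_def)
    assume "\<exists>h l. harmonic h \<and> harmonic l \<and> int (fermat k) = int h - int l"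
    then obtain h l where hl: "harmonic h" "harmonic l" "int (fermat k) = int h - int l"
      by blast
    from hl(3) have "h = l + fermat k" by linarith
    then have "h = l + (2 ^ 2 ^ k + 1)" by (simp only: fermat_def)
    moreover have "even ((2::nat) ^ k)" "(2::nat) \<le> 2 ^ k" using k N by auto
    ultimately have "(2::nat) ^ k = 2 \<or> (2::nat) ^ k = 4"
      using fermat_prime_harmonic_diff[OF hl(1,2) _ p[unfolded fermat_def]] by blast
    with N show False by linarith
  qed
qed

end
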